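(* Let $G=(V,E)$ be a graph as in the context, $v\in V$, $\emptyset\neq S\subseteq V$, $t'$ a positive integer, and $\varepsilon,\delta>0$. Pick $z$ vertices $w_1,\dots,w_z$ independently and uniformly at random from $S$, and for each $i$ let $\bar h_{w_i}$ be the estimate of $\mathbb E_G[T^{t'}_{w_i}(v)]$ obtained as the average of $T^{t'}_{w_i}(v)$ over $\kappa\ge1$ independent random walks from $w_i$. Let $\bar r(v)=t'-\frac1z\sum_{i=1}^z\bar h_{w_i}$. If $z\ge\left(\frac{t'}{2\varepsilon}\right)^2\delta^{-1}$, then $$\mathbb P\left(\left|\bar r(v)-\mathsf r^{t'}(v;S)\right|\ge\varepsilon\right)\le\delta .$$
   Context: $G=(V,E)$ is a finite directed graph with a right-stochastic transition matrix $M=(m_{ij})$, $m_{ij}=0$ if $(i,j)\notin E$. Random walks move according to $M$. $T_w(v)$ is the first time a random walk from $w$ hits $v$, and $T^{t'}_w(v)=\min\{t',T_w(v)\}$. The $t'$-bounded random-walk closeness centrality of $v$ with respect to $S$ is $\mathsf r^{t'}(v;S)=\frac1{|S|}\sum_{w\in S}\bigl(t'-\mathbb E_G[T^{t'}_w(v)]\bigr)$. *)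

theory Defs
  imports "HOL-Probability.Probability" "Graph_Theory.Pair_Digraph"
begin

locale random_walk_digraph = pair_fin_digraph G for G :: "'v pair_pre_digraph" +
  fixes m :: "'v \<Rightarrow> 'v \<Rightarrow> real"
  assumes m_nonneg: "\<And>x y. x \<in> pverts G \<Longrightarrow> y \<in> pverts G \<Longrightarrow> 0 \<le> m x y"
    and m_row_sum: "\<And>x. x \<in> pverts G \<Longrightarrow> (\<Sum>y\<in>pverts G. m x y) = 1"
    and m_non_arc: "\<And>x y. x \<in> pverts G \<Longrightarrow> y \<in> pverts G \<Longrightarrow> (x, y) \<notin> parcs G \<Longrightarrow> m x y = 0"

definition walk_space :: "'v pair_pre_digraph \<Rightarrow> (nat \<Rightarrow> 'v) measure" where
  "walk_space G = (\<Pi>\<^sub>M t\<in>UNIV. count_space (pverts G))"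

text \<open>The conditional law of the position at time \<open>t\<close> given the positions \<open>x 0, \<dots>, x (t - 1)\<close>.\<close>

primrec walk_kernel ::
  "'v pair_pre_digraph \<Rightarrow> ('v \<Rightarrow> 'v \<Rightarrow> real) \<Rightarrow> 'v \<Rightarrow> nat \<Rightarrow> (nat \<Rightarrow> 'v) \<Rightarrow> 'v measure" where
  "walk_kernel G m w 0 x = return (count_space (pverts G)) w"
| "walk_kernel G m w (Suc t) x = point_measure (pverts G) (\<lambda>y. ennreal (m (x t) y))"

text \<open>The law of the infinite random walk started at \<open>w\<close>: the Ionescu-Tulcea measure of the above
  kernels. The lemma \<open>random_walk_cylinder\<close> below gives its finite-dimensional distributions.\<close>

definition random_walk ::
  "'v pair_pre_digraph \<Rightarrow> ('v \<Rightarrow> 'v \<Rightarrow> real) \<Rightarrow> 'v \<Rightarrow> (nat \<Rightarrow> 'v) measure" where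
  "random_walk G m w =
     projective_family.lim UNIV
       (Ionescu_Tulcea.CI (walk_kernel G m w) (\<lambda>_. count_space (pverts G)))
       (\<lambda>_. count_space (pverts G))"

text \<open>Time \<open>0\<close> counts, so a walk that starts at \<open>v\<close> hits \<open>v\<close> at time \<open>0\<close>;
  the hitting time is infinite if the walk never visits \<open>v\<close>.\<close>

definition hitting_time :: "'v \<Rightarrow> (nat \<Rightarrow> 'v) \<Rightarrow> enat" where
  "hitting_time v x = (INF t\<in>{t. x t = v}. enat t)"

definition bounded_hitting_time :: "nat \<Rightarrow> 'v \<Rightarrow> (nat \<Rightarrow> 'v) \<Rightarrow> nat" where
  "bounded_hitting_time t' v x = the_enat (min (enat t') (hitting_time v x))"

definition expected_bounded_hitting_time ::
  "'v pair_pre_digraph \<Rightarrow> ('v \<Rightarrow> 'v \<Rightarrow> real) \<Rightarrow> nat \<Rightarrow> 'v \<Rightarrow> 'v \<Rightarrow> real" where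
  "expected_bounded_hitting_time G m t' w v =
     (\<integral>x. real (bounded_hitting_time t' v x) \<partial>random_walk G m w)"

definition rw_closeness ::
  "'v pair_pre_digraph \<Rightarrow> ('v \<Rightarrow> 'v \<Rightarrow> real) \<Rightarrow> nat \<Rightarrow> 'v \<Rightarrow> 'v set \<Rightarrow> real" where
  "rw_closeness G m t' v S =
     1 / real (card S) * (\<Sum>w\<in>S. real t' - expected_bounded_hitting_time G m t' w v)"

definition hitting_time_estimate :: "nat \<Rightarrow> nat \<Rightarrow> 'v \<Rightarrow> (nat \<Rightarrow> nat \<Rightarrow> 'v) \<Rightarrow> real" where
  "hitting_time_estimate \<kappa> t' v xs =
     1 / real \<kappa> * (\<Sum>j<\<kappa>. real (bounded_hitting_time t' v (xs j)))"

text \<open>The argument \<open>xss i j\<close> is the \<open>j\<close>-th walk of the \<open>i\<close>-th sample.\<close>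

definition rw_closeness_estimate ::
  "nat \<Rightarrow> nat \<Rightarrow> nat \<Rightarrow> 'v \<Rightarrow> (nat \<Rightarrow> nat \<Rightarrow> nat \<Rightarrow> 'v) \<Rightarrow> real" where
  "rw_closeness_estimate z \<kappa> t' v xss =
     real t' - 1 / real z * (\<Sum>i<z. hitting_time_estimate \<kappa> t' v (xss i))"

context random_walk_digraph
begin

lemma Ionescu_Tulcea_walk_kernel:
  assumes w: "w \<in> pverts G"
  shows "Ionescu_Tulcea (walk_kernel G m w) (\<lambda>_. count_space (pverts G))"
proof (rule Ionescu_Tulcea.intro)
  have row: "prob_space (point_measure (pverts G) (\<lambda>y. ennreal (m x y)))"
    if "x \<in> pverts G" for x
    using that m_nonneg m_row_sum pair_finite_verts
    by (intro prob_spaceI) (simp add: space_point_measure emeasure_point_measure_finite sum_ennreal)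
  fix i
  show "walk_kernel G m w i \<in>
      measurable (PiM {0..<i} (\<lambda>_. count_space (pverts G))) (subprob_algebra (count_space (pverts G)))"
  proof (cases i)
    case 0
    have "return (count_space (pverts G)) w \<in> space (subprob_algebra (count_space (pverts G)))"
      using w by (auto simp: space_subprob_algebra intro!: prob_space_imp_subprob_space prob_space_return)
    moreover have "walk_kernel G m w 0 = (\<lambda>_. return (count_space (pverts G)) w)"
      by (simp add: fun_eq_iff)
    ultimately show ?thesis using 0 by simp
  next
    case (Suc t)
    have step: "(\<lambda>x. point_measure (pverts G) (\<lambda>y. ennreal (m x y))) \<in>
        measurable (count_space (pverts G)) (subprob_algebra (count_space (pverts G)))"
      using row by (auto simp: space_subprob_algebra sets_point_measure intro: prob_space_imp_subprob_space)
    have coord: "(\<lambda>x. x t) \<in>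
        measurable (PiM {0..<i} (\<lambda>_. count_space (pverts G))) (count_space (pverts G))"
      using Suc by (intro measurable_component_singleton) auto
    have "walk_kernel G m w i = (\<lambda>x. point_measure (pverts G) (\<lambda>y. ennreal (m (x t) y)))"
      by (simp add: fun_eq_iff Suc)
    with measurable_compose[OF coord step] show ?thesis by simp
  qed
  fix x :: "nat \<Rightarrow> 'v"
  assume "x \<in> space (PiM {0..<i} (\<lambda>_. count_space (pverts G)))"
  then show "prob_space (walk_kernel G m w i x)"
    using w row by (cases i) (auto simp: space_PiM PiE_iff intro!: prob_space_return)
qed

lemma sets_random_walk:
  assumes w: "w \<in> pverts G"
  shows "sets (random_walk G m w) = sets (walk_space G)"
proof -
  interpret IT: Ionescu_Tulcea "walk_kernel G m w" "\<lambda>_. count_space (pverts G)"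
    by (rule Ionescu_Tulcea_walk_kernel[OF w])
  show ?thesis by (simp add: random_walk_def walk_space_def)
qed

lemma prob_space_random_walk:
  assumes w: "w \<in> pverts G"
  shows "prob_space (random_walk G m w)"
proof -
  interpret IT: Ionescu_Tulcea "walk_kernel G m w" "\<lambda>_. count_space (pverts G)"
    by (rule Ionescu_Tulcea_walk_kernel[OF w])
  have "distr IT.PF.lim (PiM {} (\<lambda>_. count_space (pverts G))) (\<lambda>x. restrict x {}) = IT.CI {}"
    using IT.distr_lim[of "{}"] by simp
  moreover have "prob_space (IT.CI {})" by (rule IT.PF.prob_space_P) simp_all
  ultimately have "prob_space (distr IT.PF.lim (PiM {} (\<lambda>_. count_space (pverts G))) (\<lambda>x. restrict x {}))"
    by simp
  then show ?thesis unfolding random_walk_def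
    by (rule prob_space_distrD[rotated])
       (auto simp: measurable_cong_sets[OF IT.PF.sets_lim refl] intro!: measurable_restrict)
qed

lemma random_walk_cylinder:
  assumes w: "w \<in> pverts G" and p: "\<And>t. p t \<in> pverts G"
  shows "measure (random_walk G m w) {x \<in> space (walk_space G). \<forall>t\<le>n. x t = p t} =
    (if p 0 = w then \<Prod>t<n. m (p t) (p (Suc t)) else 0)"
proof -
  let ?M = "\<lambda>_::nat. count_space (pverts G)"
  interpret IT: Ionescu_Tulcea "walk_kernel G m w" ?M
    by (rule Ionescu_Tulcea_walk_kernel[OF w])
  define r where "r n = restrict p {0..<n}" for n :: nat
  have r_space: "r n \<in> space (PiM {0..<n} ?M)" for n
    using p by (auto simp: r_def space_PiM)
  have r_sets: "{r n} \<in> sets (PiM {0..<n} ?M)" for n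
  proof -
    have "{r n} = PiE {0..<n} (\<lambda>t. {p t})"
      unfolding r_def by (auto simp: PiE_singleton[symmetric] PiE_iff extensional_def fun_eq_iff)
    also have "\<dots> \<in> sets (PiM {0..<n} ?M)"
      using p by (intro sets_PiM_I_finite) auto
    finally show ?thesis .
  qed
  have step: "emeasure (IT.C 0 (Suc n) (\<lambda>_. undefined)) {r (Suc n)} =
      emeasure (walk_kernel G m w n (r n)) {p n} * emeasure (IT.C 0 n (\<lambda>_. undefined)) {r n}" for n
  proof -
    have "emeasure (IT.C 0 (Suc n) (\<lambda>_. undefined)) {r (Suc n)} =
        (\<integral>\<^sup>+x. emeasure (IT.eP n x) {r (Suc n)} \<partial>IT.C 0 n (\<lambda>_. undefined))"
      using IT.measurable_eP[of n] r_sets[of "Suc n"] w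
      by (simp, subst emeasure_bind[where N = "PiM {0..<Suc n} ?M"])
         (auto simp: IT.space_C measurable_cong_sets[OF IT.sets_C refl])
    also have "\<dots> = (\<integral>\<^sup>+x. emeasure (walk_kernel G m w n (r n)) {p n} * indicator {r n} x
        \<partial>IT.C 0 n (\<lambda>_. undefined))"
    proof (rule nn_integral_cong)
      fix x assume "x \<in> space (IT.C 0 n (\<lambda>_. undefined))"
      then have x: "x \<in> space (PiM {0..<n} ?M)" by (simp add: IT.space_C)
      have eq: "x(n := a) = r (Suc n) \<longleftrightarrow> x = r n \<and> a = p n" for a
      proof
        assume *: "x(n := a) = r (Suc n)"
        show "x = r n \<and> a = p n"
        proof (intro conjI ext)
          show "a = p n" using fun_cong[OF *, of n] by (simp add: r_def)
          fix t show "x t = r n t"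
            using fun_cong[OF *, of t] x by (auto simp: r_def space_PiM PiE_iff extensional_def split: if_splits)
        qed
      qed (auto simp: r_def fun_eq_iff)
      have "(\<lambda>a. x(n := a)) -` {r (Suc n)} \<inter> pverts G = {a \<in> pverts G. x(n := a) = r (Suc n)}"
        by auto
      also have "\<dots> = (if x = r n then {p n} else {})"
        unfolding eq using p by auto
      finally have "(\<lambda>a. x(n := a)) -` {r (Suc n)} \<inter> pverts G = (if x = r n then {p n} else {})" .
      then show "emeasure (IT.eP n x) {r (Suc n)} =
          emeasure (walk_kernel G m w n (r n)) {p n} * indicator {r n} x"
        using IT.emeasure_eP[OF x r_sets[of "Suc n"]] by simp
    qed
    also have "\<dots> = emeasure (walk_kernel G m w n (r n)) {p n} * emeasure (IT.C 0 n (\<lambda>_. undefined)) {r n}"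
      using r_sets[of n] by (subst nn_integral_cmult_indicator) (auto simp: IT.sets_C)
    finally show ?thesis .
  qed
  have C: "emeasure (IT.C 0 (Suc n) (\<lambda>_. undefined)) {r (Suc n)} =
      ennreal (if p 0 = w then \<Prod>t<n. m (p t) (p (Suc t)) else 0)" for n
  proof (induction n)
    case 0
    have "emeasure (IT.C 0 0 (\<lambda>_. undefined)) {r 0} = 1"
    proof -
      have "r 0 = (\<lambda>_. undefined)" by (simp add: r_def fun_eq_iff)
      with r_sets[of 0] show ?thesis by simp
    qed
    then show ?case
      using p w by (simp only: step) (auto simp: indicator_def r_def fun_eq_iff)
  next
    case (Suc n)
    have "emeasure (walk_kernel G m w (Suc n) (r (Suc n))) {p (Suc n)} = ennreal (m (p n) (p (Suc n)))"
      using p pair_finite_verts by (simp add: emeasure_point_measure_finite r_def)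
    then show ?case
      using p by (simp only: step[of "Suc n"] Suc.IH)
        (auto simp: ennreal_mult''[symmetric] m_nonneg prod_nonneg mult.commute)
  qed
  have "{x \<in> space (walk_space G). \<forall>t\<le>n. x t = p t} =
      prod_emb UNIV ?M {0..<Suc n} {r (Suc n)}"
    by (auto simp: walk_space_def prod_emb_def space_PiM r_def fun_eq_iff less_Suc_eq_le) metis
  then have "emeasure (random_walk G m w) {x \<in> space (walk_space G). \<forall>t\<le>n. x t = p t} =
      emeasure (IT.CI {0..<Suc n}) {r (Suc n)}"
    unfolding random_walk_def using IT.lim[OF _ r_sets[of "Suc n"]] by simp
  also have "\<dots> = emeasure (IT.C 0 (Suc n) (\<lambda>_. undefined)) {r (Suc n)}"
  proof -
    have "prod_emb {0..<Suc n} ?M {0..<Suc n} {r (Suc n)} = {r (Suc n)}"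
      using r_space[of "Suc n"] by (intro prod_emb_id) (simp add: space_PiM)
    then show ?thesis
      using IT.emeasure_CI[OF subset_refl r_sets[of "Suc n"]] by simp
  qed
  finally show ?thesis
    by (simp only: C measure_def) (auto simp: m_nonneg p prod_nonneg)
qed

end

end

theory Submission
  imports Defs
begin

text \<open>Averaging over the uniform choice of \<open>w\<^sub>i\<close> makes each \<open>t' - h\<^sub>i\<close> an unbiased estimate of the
  closeness. These estimates are independent and lie in an interval of length \<open>t'\<close>, so by Popoviciu
  each has variance at most \<open>(t'/2)\<^sup>2\<close>, and their mean has variance at most \<open>(t'/2)\<^sup>2/z\<close>. Chebyshev's
  inequality then gives the bound \<open>(t'/(2\<epsilon>))\<^sup>2/z \<le> \<delta>\<close>.\<close>

section \<open>Variance and Chebyshev bounds for independent variables\<close>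

text \<open>Independence makes the product \<open>X * Y\<close> integrable and factorizes its
  expectation, so the covariance term in the expanded square vanishes.\<close>

lemma (in prob_space) indep_var_square_integrable_add:
  fixes X Y :: "'a \<Rightarrow> real"
  assumes indep: "indep_var borel X borel Y"
    and X: "integrable M (\<lambda>\<omega>. (X \<omega>)\<^sup>2)" and Y: "integrable M (\<lambda>\<omega>. (Y \<omega>)\<^sup>2)"
  shows "integrable M (\<lambda>\<omega>. (X \<omega> + Y \<omega>)\<^sup>2)"
    and "variance (\<lambda>\<omega>. X \<omega> + Y \<omega>) = variance X + variance Y"
proof -
  have [measurable]: "random_variable borel X" "random_variable borel Y"
    using indep by (auto dest: indep_var_rv1 indep_var_rv2)
  have iX: "integrable M X" and iY: "integrable M Y"
    using X Y by (auto intro: square_integrable_imp_integrable)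
  have iXY: "integrable M (\<lambda>\<omega>. X \<omega> * Y \<omega>)"
    by (rule indep_var_integrable[OF indep iX iY])
  have eXY: "expectation (\<lambda>\<omega>. X \<omega> * Y \<omega>) = expectation X * expectation Y"
    by (rule indep_var_lebesgue_integral[OF indep iX iY])
  show sq: "integrable M (\<lambda>\<omega>. (X \<omega> + Y \<omega>)\<^sup>2)"
    using X Y iXY by (simp add: power2_sum mult.assoc)
  show "variance (\<lambda>\<omega>. X \<omega> + Y \<omega>) = variance X + variance Y"
    using X Y iX iY iXY sq
    by (subst (1 2 3) variance_eq) (auto simp: power2_sum mult.assoc eXY)
qed

text \<open>Both conclusions share one induction: splitting off a summand requires square
  integrability of the remaining sum, which is independent of that summand.\<close>

lemma (in prob_space) indep_vars_square_integrable_sum: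
  fixes X :: "'i \<Rightarrow> 'a \<Rightarrow> real"
  assumes "finite I" and "indep_vars (\<lambda>_. borel) X I"
    and "\<And>i. i \<in> I \<Longrightarrow> integrable M (\<lambda>\<omega>. (X i \<omega>)\<^sup>2)"
  shows "integrable M (\<lambda>\<omega>. (\<Sum>i\<in>I. X i \<omega>)\<^sup>2) \<and>
    variance (\<lambda>\<omega>. \<Sum>i\<in>I. X i \<omega>) = (\<Sum>i\<in>I. variance (X i))"
  using assms
proof (induction I rule: finite_induct)
  case (insert i I)
  have IH: "integrable M (\<lambda>\<omega>. (\<Sum>i\<in>I. X i \<omega>)\<^sup>2)"
    "variance (\<lambda>\<omega>. \<Sum>i\<in>I. X i \<omega>) = (\<Sum>i\<in>I. variance (X i))"
    using insert.IH insert.prems indep_vars_subset[OF insert.prems(1) subset_insertI] by auto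
  note add = indep_var_square_integrable_add[OF
      indep_vars_sum[OF insert.hyps insert.prems(1)] insert.prems(2)[OF insertI1] IH(1)]
  show ?case
    using insert.hyps add IH(2) by simp
qed simp

text \<open>The mean minimizes the second moment, so the variance is at most the second moment about
  the midpoint of the interval.\<close>

lemma (in prob_space) variance_le_interval:
  fixes X :: "'a \<Rightarrow> real"
  assumes [measurable]: "random_variable borel X"
    and bounds: "\<And>\<omega>. \<omega> \<in> space M \<Longrightarrow> X \<omega> \<in> {a..b}"
  shows "integrable M (\<lambda>\<omega>. (X \<omega>)\<^sup>2)" and "variance X \<le> ((b - a) / 2)\<^sup>2"
proof -
  \<comment> \<open>The larger of the two absolute endpoints bounds \<open>X\<close> in absolute
    value, whatever the signs of \<open>a\<close> and \<open>b\<close>.\<close>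
  have "(X \<omega>)\<^sup>2 \<le> (max \<bar>a\<bar> \<bar>b\<bar>)\<^sup>2" if "\<omega> \<in> space M" for \<omega>
    using bounds[OF that] by (intro abs_le_square_iff[THEN iffD1]) auto
  then show sq: "integrable M (\<lambda>\<omega>. (X \<omega>)\<^sup>2)"
    by (intro integrable_const_bound[where B = "(max \<bar>a\<bar> \<bar>b\<bar>)\<^sup>2"] AE_I2) simp_all
  have iX: "integrable M X"
    by (rule square_integrable_imp_integrable[OF _ sq]) simp
  let ?c = "(a + b) / 2"
  \<comment> \<open>The added square is the squared bias of \<open>?c\<close>; with the variance it
    makes up the second moment about \<open>?c\<close>.\<close>
  have "variance X \<le> (expectation X - ?c)\<^sup>2 + variance X" by simp
  also have "\<dots> = expectation (\<lambda>\<omega>. (X \<omega> - ?c)\<^sup>2)"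
    unfolding variance_eq[OF iX sq] using sq iX
    by (simp add: power2_diff prob_space algebra_simps)
  also have "\<dots> \<le> expectation (\<lambda>_. ((b - a) / 2)\<^sup>2)"
  proof (rule integral_mono)
    show "integrable M (\<lambda>\<omega>. (X \<omega> - ?c)\<^sup>2)" using sq iX by (simp add: power2_diff)
    fix \<omega> assume "\<omega> \<in> space M"
    then have "\<bar>X \<omega> - ?c\<bar> \<le> (b - a) / 2" using bounds[of \<omega>] by (auto simp: abs_le_iff field_simps)
    then show "(X \<omega> - ?c)\<^sup>2 \<le> ((b - a) / 2)\<^sup>2" by (metis abs_ge_zero power2_abs power_mono)
  qed simp
  finally show "variance X \<le> ((b - a) / 2)\<^sup>2" by (simp add: prob_space)
qed

text \<open>The variance of the sum grows like \<open>n\<close> while the squared threshold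
  \<open>(n * \<epsilon>)\<^sup>2\<close> grows like \<open>n\<^sup>2\<close>; their quotient leaves
  the factor \<open>1/n\<close>.\<close>

lemma (in prob_space) Chebyshev_average_interval:
  fixes X :: "nat \<Rightarrow> 'a \<Rightarrow> real"
  assumes indep: "indep_vars (\<lambda>_. borel) X {..<n}"
    and bounds: "\<And>i \<omega>. i < n \<Longrightarrow> \<omega> \<in> space M \<Longrightarrow> X i \<omega> \<in> {a..b}"
    and mean: "\<And>i. i < n \<Longrightarrow> expectation (X i) = \<mu>"
    and "n > 0" and "\<epsilon> > 0"
  shows "prob {\<omega> \<in> space M. \<bar>1 / real n * (\<Sum>i<n. X i \<omega>) - \<mu>\<bar> \<ge> \<epsilon>}
    \<le> ((b - a) / (2 * \<epsilon>))\<^sup>2 / real n"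
proof -
  have rv: "random_variable borel (X i)" if "i < n" for i
    using indep that by (auto simp: indep_vars_def)
  note var = variance_le_interval[OF rv bounds]
  have iX: "integrable M (X i)" if "i < n" for i
    using rv[OF that] var(1)[OF that] by (rule square_integrable_imp_integrable) (use that in auto)
  let ?S = "\<lambda>\<omega>. \<Sum>i<n. X i \<omega>"
  have S: "integrable M (\<lambda>\<omega>. (?S \<omega>)\<^sup>2)" "variance ?S = (\<Sum>i<n. variance (X i))"
    using indep_vars_square_integrable_sum[OF finite_lessThan indep] var(1) by auto
  have rvS: "random_variable borel ?S" using rv by auto
  have ES: "expectation ?S = real n * \<mu>" using iX mean by simp
  have "variance ?S \<le> real n * ((b - a) / 2)\<^sup>2"
    unfolding S(2) using sum_mono[of "{..<n}" "\<lambda>i. variance (X i)" "\<lambda>_. ((b - a) / 2)\<^sup>2"] var(2)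
    by simp
  \<comment> \<open>Scaling the deviation by \<open>n\<close> turns the event for the average into
    one for the sum, whose variance has just been bounded.\<close>
  have "{\<omega> \<in> space M. \<bar>1 / real n * ?S \<omega> - \<mu>\<bar> \<ge> \<epsilon>} =
      {\<omega> \<in> space M. \<bar>?S \<omega> - expectation ?S\<bar> \<ge> real n * \<epsilon>}"
  proof (intro Collect_cong conj_cong refl)
    fix \<omega>
    have "?S \<omega> - expectation ?S = real n * (1 / real n * ?S \<omega> - \<mu>)"
      using \<open>n > 0\<close> unfolding ES by (simp add: field_simps)
    then show "\<epsilon> \<le> \<bar>1 / real n * ?S \<omega> - \<mu>\<bar> \<longleftrightarrow> real n * \<epsilon> \<le> \<bar>?S \<omega> - expectation ?S\<bar>"
      using \<open>n > 0\<close> by (simp only: abs_mult) simp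
  qed
  also have "prob \<dots> \<le> variance ?S / (real n * \<epsilon>)\<^sup>2"
    using \<open>n > 0\<close> \<open>\<epsilon> > 0\<close> by (intro Chebyshev_inequality rvS S(1)) simp
  also have "\<dots> \<le> (real n * ((b - a) / 2)\<^sup>2) / (real n * \<epsilon>)\<^sup>2"
    by (intro divide_right_mono) (fact, simp)
  also have "\<dots> = ((b - a) / (2 * \<epsilon>))\<^sup>2 / real n"
    using \<open>n > 0\<close> \<open>\<epsilon> > 0\<close> by (simp add: power2_eq_square field_simps)
  finally show ?thesis .
qed

section \<open>Conditioning on a uniformly distributed variable\<close>

text \<open>Conditioning on \<open>A\<close> means using the density
  \<open>indicator A / prob A\<close>. As \<open>prob A\<close> is nonzero, the extended quotient in
  \<open>uniform_measure\<close> agrees with the real one.\<close>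

lemma (in prob_space) integral_uniform_measure:
  fixes f :: "'a \<Rightarrow> real"
  assumes "A \<in> events" and "prob A \<noteq> 0" and "f \<in> borel_measurable M"
  shows "(\<integral>\<omega>. f \<omega> \<partial>uniform_measure M A) = expectation (\<lambda>\<omega>. indicator A \<omega> * f \<omega>) / prob A"
proof -
  have "uniform_measure M A = density M (\<lambda>\<omega>. ennreal (indicator A \<omega> / prob A))"
    unfolding uniform_measure_def using assms(2)
    by (intro arg_cong[of _ _ "density M"] ext)
       (auto simp: emeasure_eq_measure divide_ennreal[symmetric] zero_less_measure_iff split: split_indicator)
  then show ?thesis
    using assms by (simp add: integral_density)
qed

text \<open>This is the law of total expectation for the partition into the events
  \<open>W = w\<close>, each of probability \<open>1 / card S\<close>.\<close>

lemma (in prob_space) expectation_disintegrate_uniform: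
  fixes f :: "'a \<Rightarrow> real"
  assumes "finite S" and W: "random_variable (count_space S) W"
    and uniform: "distr M (count_space S) W = uniform_count_measure S"
    and f: "integrable M f"
  shows "expectation f =
    1 / real (card S) * (\<Sum>w\<in>S. \<integral>\<omega>. f \<omega> \<partial>uniform_measure M {\<omega> \<in> space M. W \<omega> = w})"
proof -
  let ?A = "\<lambda>w. {\<omega> \<in> space M. W \<omega> = w}"
  have vimage: "?A w = W -` {w} \<inter> space M" for w by auto
  have A: "?A w \<in> events" if "w \<in> S" for w
    unfolding vimage using that by (intro measurable_sets[OF W]) auto
  have pA: "prob (?A w) = 1 / real (card S)" if "w \<in> S" for w
  proof -
    have "prob (?A w) = measure (distr M (count_space S) W) {w}"
      unfolding vimage using that by (subst measure_distr[OF W]) auto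
    then show ?thesis
      using that \<open>finite S\<close> by (simp add: uniform measure_uniform_count_measure)
  qed
  have WS: "W \<omega> \<in> S" if "\<omega> \<in> space M" for \<omega>
    using measurable_space[OF W that] by simp
  \<comment> \<open>\<open>W\<close> takes values in \<open>S\<close>, so exactly one indicator
    equals 1 at each point.\<close>
  have "expectation f = expectation (\<lambda>\<omega>. \<Sum>w\<in>S. indicator (?A w) \<omega> * f \<omega>)"
    using WS \<open>finite S\<close>
    by (intro Bochner_Integration.integral_cong refl)
       (simp add: indicator_def if_distrib[of "\<lambda>c. c * f _"] cong: if_cong)
  also have "\<dots> = (\<Sum>w\<in>S. expectation (\<lambda>\<omega>. indicator (?A w) \<omega> * f \<omega>))"
    using f A by (intro Bochner_Integration.integral_sum integrable_mult_indicator[where 'b = real, simplified]) auto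
  also have "\<dots> = (\<Sum>w\<in>S. 1 / real (card S) * (\<integral>\<omega>. f \<omega> \<partial>uniform_measure M (?A w)))"
  proof (rule sum.cong[OF refl])
    fix w assume w: "w \<in> S"
    then have "real (card S) \<noteq> 0" using \<open>finite S\<close> by auto
    with w show "expectation (\<lambda>\<omega>. indicator (?A w) \<omega> * f \<omega>) =
        1 / real (card S) * (\<integral>\<omega>. f \<omega> \<partial>uniform_measure M (?A w))"
      using f by (subst integral_uniform_measure[OF A[OF w]]) (auto simp: pA)
  qed
  finally show ?thesis by (simp add: sum_distrib_left)
qed

section \<open>Bounded hitting times and their averages\<close>

text \<open>The disjunct \<open>t = t'\<close> caps the search, so the least element exists even if
  the walk never visits \<open>v\<close>. This form avoids \<open>enat\<close> and gives both the
  bound by \<open>t'\<close> and measurability.\<close>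

lemma bounded_hitting_time_eq_Least:
  "bounded_hitting_time t' v x = (LEAST t. t = t' \<or> x t = v)" (is "_ = ?L")
proof -
  have L: "?L = t' \<or> x ?L = v" by (rule LeastI[of _ t']) simp
  have "min (enat t') (hitting_time v x) = enat ?L"
  proof (rule antisym)
    show "min (enat t') (hitting_time v x) \<le> enat ?L"
      using L by (auto simp: hitting_time_def min_le_iff_disj intro!: INF_lower)
    show "enat ?L \<le> min (enat t') (hitting_time v x)"
      by (auto simp: hitting_time_def intro!: INF_greatest Least_le)
  qed
  then show ?thesis by (simp add: bounded_hitting_time_def)
qed

lemma bounded_hitting_time_le: "bounded_hitting_time t' v x \<le> t'"
  unfolding bounded_hitting_time_eq_Least by (rule Least_le) simp

lemma measurable_bounded_hitting_time:
  "bounded_hitting_time t' v \<in> measurable (walk_space G) (count_space UNIV)"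
proof -
  have [measurable]: "(\<lambda>x. x t) \<in> measurable (walk_space G) (count_space (pverts G))" for t
    unfolding walk_space_def by (rule measurable_component_singleton) simp
  have "(\<lambda>x. LEAST t. t = t' \<or> x t = v) \<in> measurable (walk_space G) (count_space UNIV)"
    by measurable
  then show ?thesis
    by (simp add: bounded_hitting_time_eq_Least[abs_def])
qed

lemma hitting_time_estimate_bounds: "hitting_time_estimate \<kappa> t' v xs \<in> {0..real t'}"
proof (cases "\<kappa> = 0")
  case False
  have "(\<Sum>j<\<kappa>. real (bounded_hitting_time t' v (xs j))) \<le> real \<kappa> * real t'"
    using sum_mono[of "{..<\<kappa>}" "\<lambda>j. real (bounded_hitting_time t' v (xs j))" "\<lambda>_. real t'"]
    by (simp add: bounded_hitting_time_le)
  with False show ?thesis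
    by (auto simp: hitting_time_estimate_def sum_nonneg field_simps)
\<comment> \<open>For \<open>\<kappa> = 0\<close> the convention \<open>1 / 0 = 0\<close> makes the
  estimate 0.\<close>
qed (simp add: hitting_time_estimate_def)

lemma measurable_hitting_time_estimate:
  "hitting_time_estimate \<kappa> t' v \<in> borel_measurable (\<Pi>\<^sub>M j\<in>{..<\<kappa>}. walk_space G)"
proof -
  have [measurable]: "(\<lambda>x. real (bounded_hitting_time t' v x)) \<in> borel_measurable (walk_space G)"
    using measurable_bounded_hitting_time by (rule measurable_compose) simp
  show ?thesis unfolding hitting_time_estimate_def by measurable
qed

text \<open>The product space of a sample consists of families restricted to
  \<open>{..<\<kappa>}\<close>; the estimate reads only those coordinates.\<close>

lemma hitting_time_estimate_restrict:
  "hitting_time_estimate \<kappa> t' v (\<lambda>j\<in>{..<\<kappa>}. xs j) = hitting_time_estimate \<kappa> t' v xs"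
  by (simp add: hitting_time_estimate_def)

section \<open>Unbiasedness and concentration of the closeness estimate\<close>

theorem lemma3p1:
  fixes G :: "'v pair_pre_digraph" and m :: "'v \<Rightarrow> 'v \<Rightarrow> real"
    and v :: 'v and S :: "'v set" and t' z \<kappa> :: nat and \<epsilon> \<delta> :: real
    and P :: "'w measure"
    and W :: "nat \<Rightarrow> 'w \<Rightarrow> 'v"
    and X :: "nat \<Rightarrow> nat \<Rightarrow> 'w \<Rightarrow> nat \<Rightarrow> 'v"
  assumes "random_walk_digraph G m"
    and "v \<in> pverts G" and "S \<noteq> {}" and "S \<subseteq> pverts G"
    and "t' > 0" and "\<epsilon> > 0" and "\<delta> > 0" and "\<kappa> \<ge> 1"
    and "prob_space P"
    and samples_indep: "prob_space.indep_vars P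
          (\<lambda>i. count_space S \<Otimes>\<^sub>M (\<Pi>\<^sub>M j\<in>{..<\<kappa>}. walk_space G))
          (\<lambda>i \<omega>. (W i \<omega>, \<lambda>j\<in>{..<\<kappa>}. X i j \<omega>)) {..<z}"
    and vertex_uniform: "\<And>i. i < z \<Longrightarrow> distr P (count_space S) (W i) = uniform_count_measure S"
    and walks_indep: "\<And>i w. i < z \<Longrightarrow> w \<in> S \<Longrightarrow>
          prob_space.indep_vars (uniform_measure P {\<omega> \<in> space P. W i \<omega> = w})
            (\<lambda>j. walk_space G) (X i) {..<\<kappa>}"
    and walks_law: "\<And>i j w. i < z \<Longrightarrow> j < \<kappa> \<Longrightarrow> w \<in> S \<Longrightarrow>
          distr (uniform_measure P {\<omega> \<in> space P. W i \<omega> = w}) (walk_space G) (X i j) =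
            random_walk G m w"
    and "real z \<ge> (real t' / (2 * \<epsilon>))\<^sup>2 * (1 / \<delta>)"
  shows "measure P {\<omega> \<in> space P.
           \<bar>rw_closeness_estimate z \<kappa> t' v (\<lambda>i j. X i j \<omega>) - rw_closeness G m t' v S\<bar> \<ge> \<epsilon>} \<le> \<delta>"
proof -
  interpret rw: random_walk_digraph G m by fact
  interpret prob_space P by fact
  let ?N = "count_space S \<Otimes>\<^sub>M (\<Pi>\<^sub>M j\<in>{..<\<kappa>}. walk_space G)"
  let ?E = "\<lambda>w. expected_bounded_hitting_time G m t' w v"
  let ?U = "\<lambda>i w. uniform_measure P {\<omega> \<in> space P. W i \<omega> = w}"
  let ?h = "\<lambda>i \<omega>. hitting_time_estimate \<kappa> t' v (\<lambda>j. X i j \<omega>)"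
  let ?\<mu> = "1 / real (card S) * (\<Sum>w\<in>S. ?E w)"
  have finS: "finite S" using \<open>S \<subseteq> pverts G\<close> rw.pair_finite_verts by (rule finite_subset)
  then have cardS: "real (card S) > 0" using \<open>S \<noteq> {}\<close> by (simp add: card_gt_0_iff)
  \<comment> \<open>A strictly positive lower bound on \<open>z\<close> excludes the empty
    average.\<close>
  have "(real t' / (2 * \<epsilon>))\<^sup>2 * (1 / \<delta>) > 0"
    using \<open>t' > 0\<close> \<open>\<epsilon> > 0\<close> \<open>\<delta> > 0\<close> by simp
  with assms(14) have "z > 0" by (cases z) auto

  have pair: "(\<lambda>\<omega>. (W i \<omega>, \<lambda>j\<in>{..<\<kappa>}. X i j \<omega>)) \<in> measurable P ?N" if "i < z" for i
    using samples_indep that by (auto simp: indep_vars_def)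
  have W: "random_variable (count_space S) (W i)" if "i < z" for i
    using measurable_compose[OF pair[OF that] measurable_fst] by simp
  have X: "random_variable (walk_space G) (X i j)" if "i < z" "j < \<kappa>" for i j
    using measurable_compose[OF measurable_compose[OF pair[OF that(1)] measurable_snd]
        measurable_component_singleton[of j]] that(2) by simp
  have T: "(\<lambda>x. real (bounded_hitting_time t' v x)) \<in> borel_measurable (walk_space G)"
    using measurable_bounded_hitting_time by (rule measurable_compose) simp
  note TX = measurable_compose[OF X T]
  \<comment> \<open>Each \<open>?h i\<close> is a measurable function of the walk component of the
    \<open>i\<close>-th sample, so independence of the samples passes to the estimates.\<close>
  have "(\<lambda>y. hitting_time_estimate \<kappa> t' v (snd y)) \<in> borel_measurable ?N"
    using measurable_snd measurable_hitting_time_estimate by (rule measurable_compose)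
  from indep_vars_compose2[OF samples_indep this]
  have indep: "indep_vars (\<lambda>_. borel) ?h {..<z}"
    by (simp only: snd_conv hitting_time_estimate_restrict)

  \<comment> \<open>Given \<open>W i = w\<close>, the estimate has mean \<open>?E w\<close>;
    averaging over the uniform \<open>w\<close> yields \<open>?\<mu>\<close>.\<close>
  have mean: "expectation (?h i) = ?\<mu>" if i: "i < z" for i
  proof -
    have rv: "random_variable borel (?h i)" using indep i by (auto simp: indep_vars_def)
    have "integrable P (?h i)"
      using hitting_time_estimate_bounds[of \<kappa> t' v]
      by (intro integrable_const_bound[where B = "real t'", OF _ rv] AE_I2) simp
    then have "expectation (?h i) = 1 / real (card S) * (\<Sum>w\<in>S. \<integral>\<omega>. ?h i \<omega> \<partial>?U i w)"
      by (rule expectation_disintegrate_uniform[OF finS W[OF i] vertex_uniform[OF i]])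
    also have "(\<Sum>w\<in>S. \<integral>\<omega>. ?h i \<omega> \<partial>?U i w) = (\<Sum>w\<in>S. ?E w)"
    proof (rule sum.cong[OF refl])
      fix w assume w: "w \<in> S"
      then have "w \<in> pverts G" using \<open>S \<subseteq> pverts G\<close> by auto
      \<comment> \<open>By \<open>walks_law\<close>, \<open>random_walk G m w\<close> is the image
        of the conditional measure under \<open>X i j\<close>, so change of variables transfers both
        the integral and integrability.\<close>
      have EX: "(\<integral>\<omega>. real (bounded_hitting_time t' v (X i j \<omega>)) \<partial>?U i w) = ?E w"
        and iX: "integrable (?U i w) (\<lambda>\<omega>. real (bounded_hitting_time t' v (X i j \<omega>)))"
        if j: "j < \<kappa>" for j
      proof -
        have XU: "X i j \<in> measurable (?U i w) (walk_space G)"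
          using X[OF i j] by (simp add: measurable_cong_sets[OF sets_uniform_measure refl])
        interpret rwp: prob_space "random_walk G m w"
          by (rule rw.prob_space_random_walk) fact
        show "(\<integral>\<omega>. real (bounded_hitting_time t' v (X i j \<omega>)) \<partial>?U i w) = ?E w"
          unfolding expected_bounded_hitting_time_def walks_law[OF i j w, symmetric]
          by (rule integral_distr[OF XU T, symmetric])
        have "integrable (random_walk G m w) (\<lambda>x. real (bounded_hitting_time t' v x))"
          using T rw.sets_random_walk[OF \<open>w \<in> pverts G\<close>] bounded_hitting_time_le
          by (intro rwp.integrable_const_bound[where B = "real t'"] AE_I2)
             (auto cong: measurable_cong_sets)
        then show "integrable (?U i w) (\<lambda>\<omega>. real (bounded_hitting_time t' v (X i j \<omega>)))"
          unfolding walks_law[OF i j w, symmetric] by (rule integrable_distr[OF XU])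
      qed
      have "(\<integral>\<omega>. ?h i \<omega> \<partial>?U i w) =
          1 / real \<kappa> * (\<Sum>j<\<kappa>. \<integral>\<omega>. real (bounded_hitting_time t' v (X i j \<omega>)) \<partial>?U i w)"
        unfolding hitting_time_estimate_def
        by (simp add: Bochner_Integration.integral_sum iX)
      \<comment> \<open>All \<open>\<kappa>\<close> summands equal \<open>?E w\<close>, and
        \<open>\<kappa> \<ge> 1\<close> lets the factor \<open>1 / \<kappa>\<close> cancel their
        number.\<close>
      then show "(\<integral>\<omega>. ?h i \<omega> \<partial>?U i w) = ?E w"
        using \<open>\<kappa> \<ge> 1\<close> by (simp add: EX)
    qed
    finally show ?thesis .
  qed

  \<comment> \<open>The two occurrences of \<open>t'\<close> cancel, leaving the deviation of the
    averaged estimates with its sign reversed.\<close>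
  have "rw_closeness_estimate z \<kappa> t' v (\<lambda>i j. X i j \<omega>) - rw_closeness G m t' v S =
      - (1 / real z * (\<Sum>i<z. ?h i \<omega>) - ?\<mu>)" for \<omega>
    using cardS by (simp add: rw_closeness_estimate_def rw_closeness_def sum_subtractf field_simps)
  then have "measure P {\<omega> \<in> space P.
        \<bar>rw_closeness_estimate z \<kappa> t' v (\<lambda>i j. X i j \<omega>) - rw_closeness G m t' v S\<bar> \<ge> \<epsilon>} =
      prob {\<omega> \<in> space P. \<bar>1 / real z * (\<Sum>i<z. ?h i \<omega>) - ?\<mu>\<bar> \<ge> \<epsilon>}"
    by (simp only: abs_minus_cancel)
  also have "\<dots> \<le> ((real t' - 0) / (2 * \<epsilon>))\<^sup>2 / real z"
    by (rule Chebyshev_average_interval[OF indep hitting_time_estimate_bounds mean \<open>z > 0\<close> \<open>\<epsilon> > 0\<close>])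
  \<comment> \<open>This is the lower bound on \<open>z\<close> multiplied by
    \<open>\<delta> / z\<close>.\<close>
  also have "\<dots> \<le> \<delta>"
    using assms(14) \<open>z > 0\<close> \<open>\<delta> > 0\<close>
    by (simp add: pos_divide_le_eq mult.commute del: power_divide)
  finally show ?thesis .
qed

end
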